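(* Let $m,n\ge 1$ and let $A=(a_{i_1\cdots i_m\bar{j}_1\cdots \bar{j}_m})$ be a $2m$-th order $n$-dimensional CPS (conjugate partial-symmetric) tensor. Then $A$ is Hermitian positive definite (respectively, Hermitian positive semidefinite) if and only if all $\hat{H}$-eigenvalues of $A$ are positive (respectively, nonnegative).
   Context: A $2m$-th order $n$-dimensional complex tensor is an array $A=(a_{i_1\cdots i_m\bar{j}_1\cdots \bar{j}_m})$ of complex numbers indexed by $1\le i_1,\dots,i_m,j_1,\dots,j_m\le n$ (the bars on the last $m$ indices are only notation). $A$ is conjugate partial-symmetric (CPS) if for all indices $\overline{a_{i_1\cdots i_m\bar{j}_1\cdots \bar{j}_m}}=a_{j_1\cdots j_m\bar{i}_1\cdots \bar{i}_m}$ and $a_{i_1\cdots i_m\bar{j}_1\cdots \bar{j}_m}=a_{i_{\sigma(1)}\cdots i_{\sigma(m)}\bar{j}_{\tau(1)}\cdots \bar{j}_{\tau(m)}}$ for any two independent permutations $\sigma,\tau$ of $\{1,\dots,m\}$. Put $f(A)(\mathbf{x})=\sum_{i_1,\dots,i_m,j_1,\dots,j_m=1}^n a_{i_1\cdots i_m\bar{j}_1\cdots \bar{j}_m}x_{i_1}\cdots x_{i_m}\overline{x_{j_1}}\cdots\overline{x_{j_m}}$ for $\mathbf{x}\in\mathbb{C}^n$. $A$ is Hermitian positive definite (semidefinite) if $f(A)(\mathbf{x})>0$ ($\ge 0$), in particular real, for every $\mathbf{x}\in\mathbb{C}^n\setminus\{0\}$. $\lambda\in\mathbb{C}$ is an $\hat{H}$-eigenvalue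 of $A$ if there is $\mathbf{x}=(x_1,\dots,x_n)^T\in\mathbb{C}^n\setminus\{0\}$ (an $\hat{H}$-eigenvector) such that for all $1\le i\le n$, $\sum_{i_2,\dots,i_m,j_1,\dots,j_m=1}^n a_{ii_2\cdots i_m\bar{j}_1\cdots\bar{j}_m}x_{i_2}\cdots x_{i_m}\overline{x_{j_1}}\cdots\overline{x_{j_m}}=\lambda\,\bar{x}_i|x_i|^{2m-2}$ (with $|x_i|^{0}=1$ when $m=1$). *)

theory Defs
  imports "HOL-Analysis.Analysis" "HOL-Combinatorics.Permutations"
begin

text \<open>
  The dimension is \<open>n = CARD('n)\<close>; the index range \<open>{1..n}\<close> is replaced by the finite type \<open>'n\<close>.
  An index tuple of length \<open>m\<close> is a list of length \<open>m\<close>, and a tensor of order \<open>2m\<close> takes the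
  tuple of unbarred indices and the tuple of barred indices. Only the entries
  at pairs of tuples of length \<open>m\<close> are meaningful; the others are never inspected.
\<close>

type_synonym 'n tensor = "'n list \<Rightarrow> 'n list \<Rightarrow> complex"

definition index_tuples :: "nat \<Rightarrow> 'n list set" where
  "index_tuples m = {I. length I = m}"

definition conj_partial_symmetric :: "nat \<Rightarrow> 'n tensor \<Rightarrow> bool" where
  "conj_partial_symmetric m A \<longleftrightarrow>
     (\<forall>I\<in>index_tuples m. \<forall>J\<in>index_tuples m.
        cnj (A I J) = A J I \<and>
        (\<forall>\<sigma> \<tau>. \<sigma> permutes {..<m} \<longrightarrow> \<tau> permutes {..<m} \<longrightarrow>
           A I J = A (permute_list \<sigma> I) (permute_list \<tau> J)))"

definition tensor_form :: "nat \<Rightarrow> 'n::finite tensor \<Rightarrow> complex ^ 'n \<Rightarrow> complex" where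
  "tensor_form m A x =
     (\<Sum>I\<in>index_tuples m. \<Sum>J\<in>index_tuples m.
        A I J * (\<Prod>i\<leftarrow>I. x $ i) * (\<Prod>j\<leftarrow>J. cnj (x $ j)))"

definition hermitian_pos_def :: "nat \<Rightarrow> 'n::finite tensor \<Rightarrow> bool" where
  "hermitian_pos_def m A \<longleftrightarrow>
     (\<forall>x. x \<noteq> 0 \<longrightarrow> tensor_form m A x \<in> \<real> \<and> Re (tensor_form m A x) > 0)"

definition hermitian_pos_semidef :: "nat \<Rightarrow> 'n::finite tensor \<Rightarrow> bool" where
  "hermitian_pos_semidef m A \<longleftrightarrow>
     (\<forall>x. x \<noteq> 0 \<longrightarrow> tensor_form m A x \<in> \<real> \<and> Re (tensor_form m A x) \<ge> 0)"

text \<open>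
  The definition is meant for \<open>m \<ge> 1\<close>, where the truncated subtractions are harmless. For \<open>m = 1\<close>
  the factor \<open>|x\<^sub>i|\<^sup>0\<close> is \<open>1\<close>, also when \<open>x\<^sub>i = 0\<close>.
\<close>

definition H_hat_eigenpair ::
    "nat \<Rightarrow> 'n::finite tensor \<Rightarrow> complex \<Rightarrow> complex ^ 'n \<Rightarrow> bool" where
  "H_hat_eigenpair m A \<mu> x \<longleftrightarrow>
     x \<noteq> 0 \<and>
     (\<forall>i. (\<Sum>I\<in>index_tuples (m - 1). \<Sum>J\<in>index_tuples m.
             A (i # I) J * (\<Prod>k\<leftarrow>I. x $ k) * (\<Prod>j\<leftarrow>J. cnj (x $ j)))
          = \<mu> * cnj (x $ i) * of_real (cmod (x $ i) ^ (2 * m - 2)))"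

definition H_hat_eigenvalue :: "nat \<Rightarrow> 'n::finite tensor \<Rightarrow> complex \<Rightarrow> bool" where
  "H_hat_eigenvalue m A \<mu> \<longleftrightarrow> (\<exists>x. H_hat_eigenpair m A \<mu> x)"

end

theory Submission imports Defs begin

text \<open>
  Multiplying the \<open>i\<close>-th eigenvalue equation by \<open>x\<^sub>i\<close> and summing gives
  \<open>f(A)(x) = \<lambda> \<Sum>\<^sub>i |x\<^sub>i|\<^sup>2\<^sup>m\<close>, so positivity of the form passes to the eigenvalues. Conversely, the
  quotient \<open>f(A)(x) / \<Sum>\<^sub>i |x\<^sub>i|\<^sup>2\<^sup>m\<close> is homogeneous of degree \<open>0\<close> and attains its minimum \<open>r\<close> on the
  unit sphere. At a minimiser every directional derivative of the nonnegative function
  \<open>f(A)(x) - r \<Sum>\<^sub>i |x\<^sub>i|\<^sup>2\<^sup>m\<close> vanishes, which is the eigenvalue equation for \<open>r\<close>. Hence the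
  smallest value of the quotient is itself an eigenvalue.
\<close>

text \<open>For a CPS tensor, \<open>m\<close> times this is the Wirtinger derivative of the form
  with respect to \<open>x $ i\<close>, the barred variables being held fixed.\<close>

definition tensor_gradient :: "nat \<Rightarrow> 'n::finite tensor \<Rightarrow> complex ^ 'n \<Rightarrow> 'n \<Rightarrow> complex" where
  "tensor_gradient m A x i =
     (\<Sum>I\<in>index_tuples (m - 1). \<Sum>J\<in>index_tuples m.
        A (i # I) J * (\<Prod>k\<leftarrow>I. x $ k) * (\<Prod>j\<leftarrow>J. cnj (x $ j)))"

text \<open>The \<open>2 * m\<close>-th power of the l_{2m} norm. For m at least 1 its Wirtinger
  derivative in \<open>x $ i\<close> is \<open>m\<close> times the right-hand side of the eigenvalue
  equation for eigenvalue 1.\<close>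

definition power_norm_sum :: "nat \<Rightarrow> complex ^ 'n::finite \<Rightarrow> real" where
  "power_norm_sum m x = (\<Sum>i\<in>UNIV. cmod (x $ i) ^ (2 * m))"

text \<open>Leibniz rule for the monomial of \<open>I\<close> in direction \<open>v\<close>.
  Recursion on the list avoids speaking of the tuple with one position deleted.\<close>

fun prod_list_derivative :: "('a \<Rightarrow> 'b) \<Rightarrow> ('a \<Rightarrow> 'b) \<Rightarrow> 'a list \<Rightarrow> 'b::comm_semiring_1" where
  "prod_list_derivative x v [] = 0"
| "prod_list_derivative x v (k # I) = v k * (\<Prod>i\<leftarrow>I. x i) + x k * prod_list_derivative x v I"

section \<open>Sums over index tuples and the Leibniz rule\<close>

lemma index_tuples_0 [simp]: "index_tuples 0 = {[]}"
  by (auto simp: index_tuples_def)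

lemma finite_index_tuples [simp]: "finite (index_tuples m :: 'n::finite list set)"
  using finite_lists_length_eq[of "UNIV :: 'n set" m] by (simp add: index_tuples_def)

lemma sum_index_tuples_Suc:
  fixes h :: "'n::finite list \<Rightarrow> 'b::comm_monoid_add"
  shows "(\<Sum>I\<in>index_tuples (Suc m). h I) = (\<Sum>k\<in>UNIV. \<Sum>I\<in>index_tuples m. h (k # I))"
proof -
  have "(\<Sum>k\<in>UNIV. \<Sum>I\<in>index_tuples m. h (k # I))
      = (\<Sum>(k, I)\<in>UNIV \<times> index_tuples m. h (k # I))"
    by (simp add: sum.cartesian_product)
  also have "\<dots> = (\<Sum>I\<in>index_tuples (Suc m). h I)"
    by (rule sum.reindex_bij_witness[of _ "\<lambda>I. (hd I, tl I)" "\<lambda>(k, I). k # I"])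
       (auto simp: index_tuples_def length_Suc_conv)
  finally show ?thesis ..
qed

text \<open>Symmetry of \<open>B\<close> moves the differentiated position to the front, so its
  \<open>m\<close> possible places contribute equally. Symmetry stated through \<open>mset\<close>
  is inherited by \<open>B\<close> with a fixed first entry, as the induction requires.\<close>

lemma sum_prod_list_derivative:
  fixes B :: "'n::finite list \<Rightarrow> 'b::comm_semiring_1"
  assumes "\<And>I J. I \<in> index_tuples m \<Longrightarrow> mset I = mset J \<Longrightarrow> B I = B J"
  shows "(\<Sum>I\<in>index_tuples m. B I * prod_list_derivative x v I)
       = of_nat m * (\<Sum>l\<in>UNIV. v l * (\<Sum>I\<in>index_tuples (m - 1). B (l # I) * (\<Prod>k\<leftarrow>I. x k)))"
  using assms
proof (induction m arbitrary: B)
  case 0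
  then show ?case by simp
next
  case (Suc m)
  let ?S = "\<lambda>l. \<Sum>I\<in>index_tuples m. B (l # I) * (\<Prod>k\<leftarrow>I. x k)"
  have IH: "(\<Sum>I\<in>index_tuples m. B (k # I) * prod_list_derivative x v I)
      = of_nat m * (\<Sum>l\<in>UNIV. v l * (\<Sum>I\<in>index_tuples (m - 1). B (k # l # I) * (\<Prod>k\<leftarrow>I. x k)))" for k
    by (rule Suc.IH, rule Suc.prems) (auto simp: index_tuples_def)
  \<comment> \<open>The induction hypothesis leaves the differentiated index \<open>l\<close> behind
    \<open>k\<close>. Exchanging the two lets \<open>k\<close> and \<open>I\<close> merge into one
    tuple of length \<open>m\<close>; for \<open>m = 0\<close> the factor \<open>of_nat m\<close>
    makes both sides zero.\<close>
  have swap: "of_nat m * (\<Sum>k\<in>UNIV. x k * (\<Sum>I\<in>index_tuples (m - 1). B (k # l # I) * (\<Prod>k\<leftarrow>I. x k)))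
      = of_nat m * ?S l" for l
  proof (cases m)
    case (Suc m')
    have "B (k # l # I) = B (l # k # I)" if "I \<in> index_tuples m'" for k I
      by (rule Suc.prems) (use that Suc in \<open>auto simp: index_tuples_def\<close>)
    then show ?thesis
      by (simp add: Suc sum_index_tuples_Suc sum_distrib_left mult_ac)
  qed simp
  \<comment> \<open>Differentiating the first entry gives one copy of \<open>?S\<close>; the
    remaining entries give \<open>m\<close> further copies.\<close>
  have "(\<Sum>I\<in>index_tuples (Suc m). B I * prod_list_derivative x v I)
      = (\<Sum>k\<in>UNIV. v k * ?S k) + (\<Sum>k\<in>UNIV. x k * (\<Sum>I\<in>index_tuples m. B (k # I) * prod_list_derivative x v I))"
    by (simp add: sum_index_tuples_Suc algebra_simps sum.distrib sum_distrib_left)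
  also have "(\<Sum>k\<in>UNIV. x k * (\<Sum>I\<in>index_tuples m. B (k # I) * prod_list_derivative x v I))
      = (\<Sum>k\<in>UNIV. \<Sum>l\<in>UNIV. v l * (of_nat m * (x k * (\<Sum>I\<in>index_tuples (m - 1). B (k # l # I) * (\<Prod>k\<leftarrow>I. x k)))))"
    unfolding IH by (simp only: sum_distrib_left mult_ac)
  also have "\<dots> = (\<Sum>l\<in>UNIV. v l * (of_nat m * ?S l))"
    by (subst sum.swap) (simp only: sum_distrib_left[symmetric] swap)
  finally show ?case
    by (simp add: algebra_simps sum.distrib sum_distrib_left)
qed

lemma has_vector_derivative_prod_list:
  fixes f :: "'a \<Rightarrow> real \<Rightarrow> 'b::{real_normed_algebra_1,comm_ring_1}"
  assumes "\<And>k. (f k has_vector_derivative f' k) (at t)"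
  shows "((\<lambda>t. \<Prod>k\<leftarrow>I. f k t) has_vector_derivative prod_list_derivative (\<lambda>k. f k t) f' I) (at t)"
proof (induction I)
  case (Cons k I)
  show ?case
    using has_vector_derivative_mult[OF assms[of k] Cons] by (simp add: add.commute)
qed simp

section \<open>Consequences of conjugate partial symmetry\<close>

lemma cnj_prod_list: "cnj (\<Prod>k\<leftarrow>I. x k) = (\<Prod>k\<leftarrow>I. cnj (x k))"
  by (induction I) auto

lemma conj_partial_symmetric_cnj:
  "\<lbrakk>conj_partial_symmetric m A; I \<in> index_tuples m; J \<in> index_tuples m\<rbrakk> \<Longrightarrow> cnj (A I J) = A J I"
  by (auto simp: conj_partial_symmetric_def)

lemma conj_partial_symmetric_mset:
  assumes "conj_partial_symmetric m A" "I \<in> index_tuples m" "J \<in> index_tuples m" "mset I = mset I'"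
  shows "A I J = A I' J"
proof -
  obtain p where p: "p permutes {..<length I}" "permute_list p I = I'"
    using mset_eq_permutation[of I' I] assms(4) by metis
  have "id permutes {..<m}" by (rule permutes_id)
  moreover have "permute_list id J = J" by simp
  moreover have "p permutes {..<m}" using p assms(2) by (simp add: index_tuples_def)
  ultimately show ?thesis
    using assms p(2) unfolding conj_partial_symmetric_def by metis
qed

text \<open>Conjugation exchanges the roles of the barred and unbarred tuples, and exchanging the
  two sums undoes this.\<close>

lemma tensor_form_real:
  assumes "conj_partial_symmetric m A"
  shows "tensor_form m A x \<in> \<real>"
proof -
  have "cnj (tensor_form m A x) = (\<Sum>I\<in>index_tuples m. \<Sum>J\<in>index_tuples m.
        A J I * (\<Prod>i\<leftarrow>I. cnj (x $ i)) * (\<Prod>j\<leftarrow>J. x $ j))"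
    by (simp add: tensor_form_def cnj_prod_list conj_partial_symmetric_cnj[OF assms])
  also have "\<dots> = tensor_form m A x"
    unfolding tensor_form_def by (subst sum.swap) (simp add: mult_ac)
  finally show ?thesis by (simp add: Reals_cnj_iff)
qed

lemma tensor_form_eq_gradient:
  assumes "m \<ge> 1"
  shows "tensor_form m A x = (\<Sum>i\<in>UNIV. x $ i * tensor_gradient m A x i)"
proof -
  obtain m' where "m = Suc m'" using assms by (cases m) auto
  then show ?thesis
    unfolding tensor_form_def tensor_gradient_def
    by (simp add: sum_index_tuples_Suc[of _ m'] sum_distrib_left mult_ac)
qed

section \<open>Homogeneity and powers of the modulus\<close>

lemma prod_list_scaleR:
  "I \<in> index_tuples m \<Longrightarrow> (\<Prod>k\<leftarrow>I. c * x k :: complex) = c ^ m * (\<Prod>k\<leftarrow>I. x k)"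
  unfolding index_tuples_def by (induction I arbitrary: m) auto

lemma tensor_form_scaleR:
  "tensor_form m A (c *\<^sub>R x) = of_real (c ^ (2 * m)) * tensor_form m A x"
proof -
  have "tensor_form m A (c *\<^sub>R x) = (\<Sum>I\<in>index_tuples m. \<Sum>J\<in>index_tuples m.
        of_real c ^ (2 * m) * (A I J * (\<Prod>i\<leftarrow>I. x $ i) * (\<Prod>j\<leftarrow>J. cnj (x $ j))))"
    unfolding tensor_form_def vector_scaleR_component
    by (intro sum.cong refl)
       (simp add: prod_list_scaleR scaleR_conv_of_real mult_2 power_add)
  then show ?thesis by (simp add: tensor_form_def sum_distrib_left)
qed

lemma power_norm_sum_scaleR:
  "power_norm_sum m (c *\<^sub>R x) = c ^ (2 * m) * power_norm_sum m x"
  by (simp add: power_norm_sum_def power_mult_distrib sum_distrib_left power_mult)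

lemma power_norm_sum_pos:
  assumes "x \<noteq> 0"
  shows "power_norm_sum m x > 0"
proof -
  obtain i where "x $ i \<noteq> 0" using assms by (auto simp: vec_eq_iff)
  then show ?thesis
    unfolding power_norm_sum_def by (intro sum_pos2[of _ i]) auto
qed

text \<open>As a polynomial in \<open>z\<close> and \<open>cnj z\<close>, the even power can be
  differentiated without treating \<open>z = 0\<close> separately, where \<open>cmod\<close> itself
  is not smooth.\<close>

lemma of_real_cmod_power: "of_real (cmod z ^ (2 * m)) = z ^ m * cnj z ^ m"
proof -
  have "of_real (cmod z ^ (2 * m)) = (of_real ((cmod z)\<^sup>2) :: complex) ^ m"
    by (simp add: power_mult)
  also have "\<dots> = z ^ m * cnj z ^ m"
    by (simp only: complex_norm_square power_mult_distrib)
  finally show ?thesis .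
qed

lemma mult_cnj_cmod_power:
  assumes "m \<ge> 1"
  shows "z * (cnj z * of_real (cmod z ^ (2 * m - 2))) = of_real (cmod z ^ (2 * m))"
    and "z ^ (m - 1) * cnj z ^ m = cnj z * of_real (cmod z ^ (2 * m - 2))"
proof -
  obtain m' where "m = Suc m'" using assms by (cases m) auto
  moreover have "2 * Suc m' - 2 = 2 * m'" by simp
  ultimately show "z * (cnj z * of_real (cmod z ^ (2 * m - 2))) = of_real (cmod z ^ (2 * m))"
    "z ^ (m - 1) * cnj z ^ m = cnj z * of_real (cmod z ^ (2 * m - 2))"
    by (simp_all only: of_real_cmod_power) simp_all
qed

section \<open>The eigenvalue equation and derivatives along lines\<close>

lemma H_hat_eigenpair_gradient:
  "H_hat_eigenpair m A \<mu> x \<longleftrightarrow>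
     x \<noteq> 0 \<and> (\<forall>i. tensor_gradient m A x i = \<mu> * (cnj (x $ i) * of_real (cmod (x $ i) ^ (2 * m - 2))))"
  by (simp add: H_hat_eigenpair_def tensor_gradient_def mult.assoc)

lemma H_hat_eigenpair_form:
  assumes "m \<ge> 1" "H_hat_eigenpair m A \<mu> x"
  shows "tensor_form m A x = \<mu> * of_real (power_norm_sum m x)"
proof -
  have "x $ i * tensor_gradient m A x i = \<mu> * of_real (cmod (x $ i) ^ (2 * m))" for i
    using assms(2) mult_cnj_cmod_power(1)[OF assms(1), of "x $ i"]
    by (simp add: H_hat_eigenpair_gradient mult.left_commute)
  then show ?thesis
    by (simp add: tensor_form_eq_gradient[OF assms(1)] power_norm_sum_def sum_distrib_left)
qed

text \<open>\<open>?S\<close> collects the derivatives of the unbarred factors, \<open>?T\<close>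
  those of the barred ones. Hermitian symmetry makes them conjugate, which gives the factor 2;
  permutation symmetry gives the factor \<open>m\<close>.\<close>

lemma tensor_form_line_derivative:
  assumes "conj_partial_symmetric m A"
  shows "((\<lambda>t. Re (tensor_form m A (x + t *\<^sub>R v))) has_real_derivative
           2 * of_nat m * Re (\<Sum>i\<in>UNIV. v $ i * tensor_gradient m A x i)) (at 0)"
proof -
  let ?D = "prod_list_derivative (($) x) (($) v)"
  let ?S = "\<Sum>I\<in>index_tuples m. \<Sum>J\<in>index_tuples m. A I J * ?D I * (\<Prod>j\<leftarrow>J. cnj (x $ j))"
  let ?T = "\<Sum>I\<in>index_tuples m. \<Sum>J\<in>index_tuples m. A I J * (\<Prod>i\<leftarrow>I. x $ i) * cnj (?D J)"
  have line: "((\<lambda>t::real. x $ k + t *\<^sub>R v $ k) has_vector_derivative v $ k) (at 0)" for k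
    by (auto intro!: derivative_eq_intros)
  have D: "((\<lambda>t::real. \<Prod>k\<leftarrow>I. x $ k + t *\<^sub>R v $ k) has_vector_derivative ?D I) (at 0)" for I
    using has_vector_derivative_prod_list[OF line, where I = I] by simp
  have Dc: "((\<lambda>t::real. \<Prod>k\<leftarrow>I. cnj (x $ k + t *\<^sub>R v $ k)) has_vector_derivative cnj (?D I)) (at 0)" for I
    using has_vector_derivative_cnj[OF D[of I]] by (simp only: cnj_prod_list)
  have "((\<lambda>t. tensor_form m A (x + t *\<^sub>R v)) has_vector_derivative
       (\<Sum>I\<in>index_tuples m. \<Sum>J\<in>index_tuples m.
          A I J * (\<Prod>i\<leftarrow>I. x $ i) * cnj (?D J) + A I J * ?D I * (\<Prod>j\<leftarrow>J. cnj (x $ j)))) (at 0)"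
    unfolding tensor_form_def vector_add_component vector_scaleR_component
  proof (intro has_vector_derivative_sum)
    fix I J
    show "((\<lambda>t. A I J * (\<Prod>i\<leftarrow>I. x $ i + t *\<^sub>R v $ i) * (\<Prod>j\<leftarrow>J. cnj (x $ j + t *\<^sub>R v $ j)))
        has_vector_derivative
        A I J * (\<Prod>i\<leftarrow>I. x $ i) * cnj (?D J) + A I J * ?D I * (\<Prod>j\<leftarrow>J. cnj (x $ j))) (at 0)"
      using has_vector_derivative_mult[OF has_vector_derivative_mult_right[OF D[of I], of "A I J"] Dc[of J]]
      by simp
  qed
  then have 1: "((\<lambda>t. tensor_form m A (x + t *\<^sub>R v)) has_vector_derivative ?T + ?S) (at 0)"
    by (simp add: sum.distrib)
  have "cnj ?S = (\<Sum>I\<in>index_tuples m. \<Sum>J\<in>index_tuples m. A J I * cnj (?D I) * (\<Prod>j\<leftarrow>J. x $ j))"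
    by (simp add: cnj_prod_list conj_partial_symmetric_cnj[OF assms])
  also have "\<dots> = ?T"
    by (subst sum.swap) (simp add: mult_ac)
  finally have T: "?T = cnj ?S" ..
  \<comment> \<open>Summing over \<open>I\<close> innermost presents, for each fixed
    \<open>J\<close>, a sum with symmetric coefficients in \<open>I\<close>, to which
    \<open>sum_prod_list_derivative\<close> applies.\<close>
  have "?S = (\<Sum>J\<in>index_tuples m. (\<Prod>j\<leftarrow>J. cnj (x $ j)) * (\<Sum>I\<in>index_tuples m. A I J * ?D I))"
    by (subst sum.swap) (simp add: sum_distrib_left mult_ac)
  also have "\<dots> = (\<Sum>J\<in>index_tuples m. (\<Prod>j\<leftarrow>J. cnj (x $ j)) * (of_nat m *
      (\<Sum>l\<in>UNIV. v $ l * (\<Sum>I\<in>index_tuples (m - 1). A (l # I) J * (\<Prod>k\<leftarrow>I. x $ k)))))"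
    by (intro sum.cong refl arg_cong2[where f = "(*)"] sum_prod_list_derivative)
       (auto intro: conj_partial_symmetric_mset[OF assms])
  also have "\<dots> = (\<Sum>J\<in>index_tuples m. \<Sum>l\<in>UNIV. of_nat m * (v $ l *
      (\<Sum>I\<in>index_tuples (m - 1). A (l # I) J * (\<Prod>k\<leftarrow>I. x $ k) * (\<Prod>j\<leftarrow>J. cnj (x $ j)))))"
    by (simp add: sum_distrib_left sum_distrib_right mult_ac)
  also have "\<dots> = of_nat m * (\<Sum>l\<in>UNIV. v $ l * (\<Sum>J\<in>index_tuples m.
      \<Sum>I\<in>index_tuples (m - 1). A (l # I) J * (\<Prod>k\<leftarrow>I. x $ k) * (\<Prod>j\<leftarrow>J. cnj (x $ j))))"
    by (subst sum.swap) (simp only: sum_distrib_left)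
  also have "\<dots> = of_nat m * (\<Sum>l\<in>UNIV. v $ l * tensor_gradient m A x l)"
    unfolding tensor_gradient_def by (subst sum.swap) simp
  finally have S: "?S = of_nat m * (\<Sum>l\<in>UNIV. v $ l * tensor_gradient m A x l)" .
  have "Re (?T + ?S) = 2 * of_nat m * Re (\<Sum>i\<in>UNIV. v $ i * tensor_gradient m A x i)"
    unfolding T unfolding S by simp
  then show ?thesis
    using 1 by (simp add: has_vector_derivative_complex_iff)
qed

lemma power_norm_sum_line_derivative:
  assumes "m \<ge> 1"
  shows "((\<lambda>t. power_norm_sum m (x + t *\<^sub>R v)) has_real_derivative
           2 * of_nat m * Re (\<Sum>i\<in>UNIV. v $ i * (cnj (x $ i) * of_real (cmod (x $ i) ^ (2 * m - 2))))) (at 0)"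
proof -
  have "((\<lambda>t. cmod (x $ i + t *\<^sub>R v $ i) ^ (2 * m)) has_real_derivative
      2 * of_nat m * Re (v $ i * (cnj (x $ i) * of_real (cmod (x $ i) ^ (2 * m - 2))))) (at 0)" for i
  proof -
    let ?z = "x $ i" and ?w = "v $ i"
    let ?d = "of_nat m * ?w * ?z ^ (m - 1)"
    \<comment> \<open>The base point is written as the value of the line at 0, the shape that the
      chain rule expects.\<close>
    have "((\<lambda>z. z ^ m) has_field_derivative of_nat m * ?z ^ (m - 1)) (at (?z + 0 *\<^sub>R ?w))"
      by (auto intro!: derivative_eq_intros)
    moreover have "((\<lambda>t::real. ?z + t *\<^sub>R ?w) has_vector_derivative ?w) (at 0)"
      by (auto intro!: derivative_eq_intros)
    ultimately have d: "((\<lambda>t::real. (?z + t *\<^sub>R ?w) ^ m) has_vector_derivative ?d) (at 0)"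
      using field_vector_diff_chain_at[of "\<lambda>t::real. ?z + t *\<^sub>R ?w" ?w 0 "\<lambda>z. z ^ m" "of_nat m * ?z ^ (m - 1)"]
      by (simp add: o_def mult_ac)
    have deriv: "((\<lambda>t::real. of_real (cmod (?z + t *\<^sub>R ?w) ^ (2 * m)) :: complex) has_vector_derivative
        ?z ^ m * cnj ?d + ?d * cnj ?z ^ m) (at 0)"
      using has_vector_derivative_mult[OF d has_vector_derivative_cnj[OF d]]
      by (simp only: of_real_cmod_power complex_cnj_power) simp
    have "?d * cnj ?z ^ m = of_nat m * (?w * (cnj ?z * of_real (cmod ?z ^ (2 * m - 2))))"
      by (simp only: mult.assoc mult_cnj_cmod_power(2)[OF assms])
    \<comment> \<open>The two terms of the product rule are conjugate to each other.\<close>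
    moreover have "Re (?z ^ m * cnj ?d + ?d * cnj ?z ^ m) = 2 * Re (?d * cnj ?z ^ m)"
    proof -
      have "?z ^ m * cnj ?d = cnj (?d * cnj ?z ^ m)"
        by (simp add: mult_ac)
      then show ?thesis by (simp only: plus_complex.sel cnj.sel)
    qed
    ultimately have "Re (?z ^ m * cnj ?d + ?d * cnj ?z ^ m)
        = 2 * of_nat m * Re (?w * (cnj ?z * of_real (cmod ?z ^ (2 * m - 2))))"
      by (simp only:) simp
    with deriv show ?thesis
      by (simp only: has_vector_derivative_complex_iff Re_complex_of_real)
  qed
  then show ?thesis
    unfolding power_norm_sum_def vector_add_component vector_scaleR_component Re_sum sum_distrib_left
    by (rule DERIV_sum)
qed

section \<open>Minimising the quotient on the unit sphere\<close>

lemma continuous_on_prod_list: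
  fixes f :: "'a \<Rightarrow> 'b::topological_space \<Rightarrow> 'c::real_normed_algebra_1"
  assumes "\<And>k. continuous_on S (f k)"
  shows "continuous_on S (\<lambda>x. \<Prod>k\<leftarrow>I. f k x)"
  by (induction I) (simp_all add: continuous_on_mult assms)

lemma continuous_on_tensor_form: "continuous_on S (tensor_form m A)"
  unfolding tensor_form_def by (intro continuous_intros continuous_on_prod_list)

lemma continuous_on_power_norm_sum: "continuous_on S (power_norm_sum m)"
  unfolding power_norm_sum_def by (intro continuous_intros)

lemma exists_minimal_H_hat_eigenpair:
  fixes A :: "'n::finite tensor"
  assumes m: "m \<ge> 1" and A: "conj_partial_symmetric m A"
  obtains r x where "H_hat_eigenpair m A (of_real r) x"
    and "\<And>y. r * power_norm_sum m y \<le> Re (tensor_form m A y)"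
proof -
  let ?q = "\<lambda>y. Re (tensor_form m A y) / power_norm_sum m y"
  have pos: "power_norm_sum m y > 0" if "y \<in> sphere 0 1" for y :: "complex ^ 'n"
    using that by (intro power_norm_sum_pos) auto
  obtain z :: "complex ^ 'n" where "norm z = 1"
    using vector_choose_size[of 1] by auto
  then have "sphere 0 1 \<noteq> ({} :: (complex ^ 'n) set)"
    by auto
  moreover have "continuous_on (sphere 0 1) ?q"
    using pos by (intro continuous_intros continuous_on_tensor_form continuous_on_power_norm_sum)
      (metis less_irrefl)
  ultimately obtain x where x: "x \<in> sphere 0 1" and min: "\<And>y. y \<in> sphere 0 1 \<Longrightarrow> ?q x \<le> ?q y"
    using continuous_attains_inf[of "sphere 0 1" ?q] by auto
  define r where "r = ?q x"
  have le: "r * power_norm_sum m y \<le> Re (tensor_form m A y)" for y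
  proof -
    \<comment> \<open>Both sides are homogeneous of degree \<open>2 * m\<close>, so a unit vector in
      the direction of \<open>y\<close> suffices; for \<open>y = 0\<close> any unit vector serves,
      here \<open>x\<close>.\<close>
    obtain u where u: "u \<in> sphere 0 1" "y = norm y *\<^sub>R u"
    proof (cases "y = 0")
      case True
      with that[of x] x show ?thesis by simp
    next
      case False
      with that[of "y /\<^sub>R norm y"] show ?thesis by simp
    qed
    have "r * power_norm_sum m u \<le> Re (tensor_form m A u)"
      using min[OF u(1)] pos[OF u(1)] by (simp add: r_def[symmetric] pos_le_divide_eq)
    then have "norm y ^ (2 * m) * (r * power_norm_sum m u) \<le> norm y ^ (2 * m) * Re (tensor_form m A u)"
      by (intro mult_left_mono) auto
    then have "r * power_norm_sum m (norm y *\<^sub>R u) \<le> Re (tensor_form m A (norm y *\<^sub>R u))"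
      by (simp add: tensor_form_scaleR power_norm_sum_scaleR mult.left_commute del: of_real_power)
    then show ?thesis
      by (simp only: u(2)[symmetric])
  qed
  \<comment> \<open>The defect in the \<open>i\<close>-th eigenvalue equation for the candidate
    \<open>r\<close>.\<close>
  define e where "e i = tensor_gradient m A x i - of_real r * (cnj (x $ i) * of_real (cmod (x $ i) ^ (2 * m - 2)))" for i
  \<comment> \<open>The derivative in the direction of the conjugate defect is a multiple of its squared norm.\<close>
  define v where "v = (\<chi> i. cnj (e i))"
  let ?g = "\<lambda>t. Re (tensor_form m A (x + t *\<^sub>R v)) - r * power_norm_sum m (x + t *\<^sub>R v)"
  have "(?g has_real_derivative
      2 * of_nat m * Re (\<Sum>i\<in>UNIV. v $ i * tensor_gradient m A x i)
      - r * (2 * of_nat m * Re (\<Sum>i\<in>UNIV. v $ i * (cnj (x $ i) * of_real (cmod (x $ i) ^ (2 * m - 2)))))) (at 0)"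
    by (intro DERIV_diff DERIV_cmult tensor_form_line_derivative[OF A] power_norm_sum_line_derivative[OF m])
  moreover have "2 * of_nat m * Re (\<Sum>i\<in>UNIV. v $ i * tensor_gradient m A x i)
      - r * (2 * of_nat m * Re (\<Sum>i\<in>UNIV. v $ i * (cnj (x $ i) * of_real (cmod (x $ i) ^ (2 * m - 2)))))
      = 2 * of_nat m * Re (\<Sum>i\<in>UNIV. v $ i * e i)"
  proof -
    have "(\<Sum>i\<in>UNIV. v $ i * e i) = (\<Sum>i\<in>UNIV. v $ i * tensor_gradient m A x i)
       - of_real r * (\<Sum>i\<in>UNIV. v $ i * (cnj (x $ i) * of_real (cmod (x $ i) ^ (2 * m - 2))))"
      unfolding e_def right_diff_distrib sum_subtractf sum_distrib_left by (simp only: mult_ac)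
    then have "Re (\<Sum>i\<in>UNIV. v $ i * e i) = Re (\<Sum>i\<in>UNIV. v $ i * tensor_gradient m A x i)
       - r * Re (\<Sum>i\<in>UNIV. v $ i * (cnj (x $ i) * of_real (cmod (x $ i) ^ (2 * m - 2))))"
      by (simp only: minus_complex.sel Re_complex_of_real Im_complex_of_real times_complex.sel)
    then show ?thesis by (simp only: right_diff_distrib mult_ac)
  qed
  ultimately have deriv: "(?g has_real_derivative 2 * of_nat m * Re (\<Sum>i\<in>UNIV. v $ i * e i)) (at 0)"
    by simp
  \<comment> \<open>\<open>?g 0\<close> is zero because \<open>r\<close> is the quotient at
    \<open>x\<close>, and \<open>le\<close> makes \<open>?g\<close> nonnegative. The minimum is
    global, so the radius 1 used next is arbitrary.\<close>
  have "?g 0 \<le> ?g t" for t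
    using le[of "x + t *\<^sub>R v"] pos[OF x] by (simp add: r_def)
  then have "2 * of_nat m * Re (\<Sum>i\<in>UNIV. v $ i * e i) = 0"
    by (intro DERIV_local_min[OF deriv zero_less_one]) auto
  moreover have "Re (\<Sum>i\<in>UNIV. v $ i * e i) = (\<Sum>i\<in>UNIV. (cmod (e i))\<^sup>2)"
    unfolding Re_sum v_def by (simp only: cmod_power2) (simp add: power2_eq_square)
  ultimately have "\<forall>i. e i = 0"
    using m by (simp add: sum_nonneg_eq_0_iff)
  then have "H_hat_eigenpair m A (of_real r) x"
    using x by (auto simp: H_hat_eigenpair_gradient e_def)
  with le that show ?thesis by blast
qed

section \<open>Signs of the form and of the eigenvalues\<close>

theorem theorem1p4:
  fixes m :: nat and A :: "'n::finite tensor"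
  assumes "m \<ge> 1"
    and "conj_partial_symmetric m A"
  shows "(hermitian_pos_def m A \<longleftrightarrow>
            (\<forall>\<mu>. H_hat_eigenvalue m A \<mu> \<longrightarrow> \<mu> \<in> \<real> \<and> Re \<mu> > 0)) \<and>
         (hermitian_pos_semidef m A \<longleftrightarrow>
            (\<forall>\<mu>. H_hat_eigenvalue m A \<mu> \<longrightarrow> \<mu> \<in> \<real> \<and> Re \<mu> \<ge> 0))"
proof -
  \<comment> \<open>An eigenvalue is the quotient of the real form value at an eigenvector by a
    positive number: it is real and shares the sign of that value.\<close>
  have form: "\<exists>x. x \<noteq> 0 \<and> power_norm_sum m x > 0 \<and> \<mu> \<in> \<real> \<and>
      Re (tensor_form m A x) = Re \<mu> * power_norm_sum m x"
    if \<mu>: "H_hat_eigenvalue m A \<mu>" for \<mu>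
  proof -
    obtain x where x: "H_hat_eigenpair m A \<mu> x"
      using \<mu> by (auto simp: H_hat_eigenvalue_def)
    then have "x \<noteq> 0" by (simp add: H_hat_eigenpair_def)
    then have pos: "power_norm_sum m x > 0" by (rule power_norm_sum_pos)
    have eq: "tensor_form m A x = \<mu> * of_real (power_norm_sum m x)"
      by (rule H_hat_eigenpair_form[OF assms(1) x])
    then have "\<mu> = tensor_form m A x / of_real (power_norm_sum m x)"
      using pos by simp
    also have "\<dots> \<in> \<real>"
      using tensor_form_real[OF assms(2)] by (intro Reals_divide) auto
    finally show ?thesis
      using \<open>x \<noteq> 0\<close> pos eq by auto
  qed
  \<comment> \<open>An eigenvalue always exists, so the condition on all eigenvalues is never
    vacuous; applied to this \<open>r\<close>, it bounds the form from below at every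
    \<open>y\<close>.\<close>
  obtain r x where r: "H_hat_eigenvalue m A (of_real r)"
      and le: "\<And>y. r * power_norm_sum m y \<le> Re (tensor_form m A y)"
    using exists_minimal_H_hat_eigenpair[OF assms] unfolding H_hat_eigenvalue_def by metis
  show ?thesis
  proof (intro conjI iffI)
    assume "hermitian_pos_def m A"
    then show "\<forall>\<mu>. H_hat_eigenvalue m A \<mu> \<longrightarrow> \<mu> \<in> \<real> \<and> Re \<mu> > 0"
      unfolding hermitian_pos_def_def using form by (metis zero_less_mult_pos2)
  next
    assume "\<forall>\<mu>. H_hat_eigenvalue m A \<mu> \<longrightarrow> \<mu> \<in> \<real> \<and> Re \<mu> > 0"
    with r have "r > 0" by force
    then have "Re (tensor_form m A y) > 0" if "y \<noteq> 0" for y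
      using le[of y] power_norm_sum_pos[OF that, of m] by (meson less_le_trans mult_pos_pos)
    then show "hermitian_pos_def m A"
      by (simp add: hermitian_pos_def_def tensor_form_real[OF assms(2)])
  next
    assume "hermitian_pos_semidef m A"
    then show "\<forall>\<mu>. H_hat_eigenvalue m A \<mu> \<longrightarrow> \<mu> \<in> \<real> \<and> Re \<mu> \<ge> 0"
      unfolding hermitian_pos_semidef_def using form by (metis zero_le_mult_iff not_less)
  next
    assume "\<forall>\<mu>. H_hat_eigenvalue m A \<mu> \<longrightarrow> \<mu> \<in> \<real> \<and> Re \<mu> \<ge> 0"
    with r have "r \<ge> 0" by force
    then have "Re (tensor_form m A y) \<ge> 0" if "y \<noteq> 0" for y
      using le[of y] power_norm_sum_pos[OF that, of m] by (meson order_trans mult_nonneg_nonneg less_imp_le)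
    then show "hermitian_pos_semidef m A"
      by (simp add: hermitian_pos_semidef_def tensor_form_real[OF assms(2)])
  qed
qed

end
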